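(* For every Ferrers shape $F_\lambda$, there exists a bijection from the set of $F_\lambda$-Dumont permutations to the set of complete $F_\lambda$-Callan sequences.
   Context: Given a partition $\lambda=(\lambda_1\ge\lambda_2\ge\dots\ge\lambda_n\geq 1)$, the Ferrers shape $F_\lambda$ is the arrangement of cells justified to the left and to the bottom with $n$ rows, where the $i$-th row from the bottom has $\lambda_i$ cells. Canonical labeling: walk along the northeast border of $F_\lambda$ from the bottom right corner to the top left corner and label the successive unit border edges $1,2,3,\dots$; a vertical edge labels the row it ends, a horizontal edge labels the column it tops (so the bottom row gets label $1$). Explicitly, the $i$-th row from the bottom has label $i+\lambda_1-\lambda_i$, and the $j$-th column from the right, having $h$ cells, has label $j+h$. $L_r(F_\lambda)$ and $L_c(F_\lambda)$ denote the sets of labels of rows and of columns. The semiperimeter is $s=n+\lambda_1$, and $L_r(F_\lambda)$, $L_c(F_\lambda)$ partition $\{1,\dots,s\}$. An $F_\lambda$-Callan sequence is a sequence $(R_1,C_1),\dots,(R_m,C_m)$, for some integer $m\ge 0$, such that $R_1,\dots,R_m$ are pairwise disjoint nonempty subsets of $L_r(F_\lambda)$, $C_1,\dots,C_m$ are pairwise disjoint nonempty subsets of $L_c(F_\lambda)$, and $\max R_i<\min C_i$ for all $i$. It is complete if $\bigcup_{i=1}^m C_i=L_c(F_\lambda)$. For a permutation $\alpha=a_1a_2\dots a_N$ of $\{1,\dots,N\}$, $a_i$ is an ascent bottom if $i\le N-1$ and $a_i<a_{i+1}$; $A(\alpha)$ is the set of ascent bottoms. An $F_\lambda$-Dumont permutation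 is a permutation $\delta=d_1d_2\dots d_{s+1}$ of $\{1,\dots,s+1\}$ with $d_{s+1}=s+1$ and $A(\delta)=L_r(F_\lambda)$. *)

theory Defs
  imports Main "HOL-Library.Disjoint_Sets" "HOL-Combinatorics.Multiset_Permutations"
begin

definition is_partition :: "nat list \<Rightarrow> bool" where
  "is_partition lam \<longleftrightarrow> sorted_wrt (\<ge>) lam \<and> (\<forall>x\<in>set lam. 1 \<le> x)"

(* The empty partition is admitted; its first part is read as 0. *)
definition first_part :: "nat list \<Rightarrow> nat" where
  "first_part lam = (case lam of [] \<Rightarrow> 0 | x # _ \<Rightarrow> x)"

(* Rows are numbered from the bottom and columns from the left, both from 1,
   so the i-th part is the list entry at index i - 1. *)
definition ferrers :: "nat list \<Rightarrow> (nat \<times> nat) set" where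
  "ferrers lam = {(i, c). 1 \<le> i \<and> i \<le> length lam \<and> 1 \<le> c \<and> c \<le> lam ! (i - 1)}"

definition semiperimeter :: "nat list \<Rightarrow> nat" where
  "semiperimeter lam = length lam + first_part lam"

(* The truncated subtraction is exact because the first part is the largest. *)
definition row_label :: "nat list \<Rightarrow> nat \<Rightarrow> nat" where
  "row_label lam i = i + first_part lam - lam ! (i - 1)"

(* The j-th column from the right is column first_part lam + 1 - j from the left. *)
definition col_height :: "nat list \<Rightarrow> nat \<Rightarrow> nat" where
  "col_height lam j = card {i. (i, first_part lam + 1 - j) \<in> ferrers lam}"

definition col_label :: "nat list \<Rightarrow> nat \<Rightarrow> nat" where
  "col_label lam j = j + col_height lam j"

definition row_labels :: "nat list \<Rightarrow> nat set" where
  "row_labels lam = row_label lam ` {1..length lam}"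

definition col_labels :: "nat list \<Rightarrow> nat set" where
  "col_labels lam = col_label lam ` {1..first_part lam}"

(* Max and Min below are applied only to finite nonempty sets: the components
   are nonempty subsets of the finite label sets. *)
definition callan_sequence :: "nat list \<Rightarrow> (nat set \<times> nat set) list \<Rightarrow> bool" where
  "callan_sequence lam S \<longleftrightarrow>
     (\<forall>(R, C) \<in> set S. R \<noteq> {} \<and> R \<subseteq> row_labels lam \<and>
                       C \<noteq> {} \<and> C \<subseteq> col_labels lam \<and> Max R < Min C) \<and>
     disjoint_family_on (\<lambda>i. fst (S ! i)) {..<length S} \<and>
     disjoint_family_on (\<lambda>i. snd (S ! i)) {..<length S}"

definition complete_callan_sequences :: "nat list \<Rightarrow> (nat set \<times> nat set) list set" where
  "complete_callan_sequences lam =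
     {S. callan_sequence lam S \<and> (\<Union>(R, C) \<in> set S. C) = col_labels lam}"

definition ascent_bottoms :: "nat list \<Rightarrow> nat set" where
  "ascent_bottoms a = {a ! i | i. Suc i < length a \<and> a ! i < a ! Suc i}"

(* permutations_of_set A is the set of one-line words listing A without repetition. *)
definition dumont_permutations :: "nat list \<Rightarrow> nat list set" where
  "dumont_permutations lam =
     {d \<in> permutations_of_set {1..semiperimeter lam + 1}.
        last d = semiperimeter lam + 1 \<and> ascent_bottoms d = row_labels lam}"

end

theory Submission
  imports Defs
begin

text \<open>
  Both sets are finite, so it suffices to count them, and both counts depend only on the word that
  records, for the labels from the largest down to \<open>1\<close>, whether the label belongs to a row
  (\<open>True\<close>) or to a column (\<open>False\<close>). They are shown to equal the same number
  \<open>completions w 0 0\<close>.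

  A complete Callan sequence is built by scanning the labels downwards. A column label joins a block
  that still has no row label, or starts such an open block; a row label is left unused, joins
  a block that already has row labels, or is the first row label of an open block, which is then
  closed. Scanning downwards makes \<open>max R < min C\<close> automatic. The state is a pair
  \<open>(p, q)\<close> of numbers of open and closed blocks, \<open>completions\<close> is the resulting transfer
  recursion, and its final value \<open>q!\<close> accounts for the order of the blocks
  (lemmas \<open>card_colourings\<close> and \<open>card_complete_callan_sequences\<close>).

  On Dumont permutations a different recursion is visible. Let \<open>r < c\<close> be neighbouring labels,
  \<open>r\<close> a row and \<open>c\<close> a column. If \<open>r\<close> and \<open>c\<close> are not adjacent in the permutation,
  exchanging them gives a permutation for the labelling with the two types exchanged. If they are
  adjacent, one of them can be deleted: what follows decides between ascent and descent, so
  \<open>r c\<close> contracts to the column \<open>c\<close> and \<open>c r\<close> to the row \<open>r\<close>. With \<open>N\<close> the number of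
  permutations this reads
  \<open>N (u C R v) = N (u R C v) + N (u C v) + N (u R v)\<close>,
  and together with the boundary rules \<open>N (R w) = N (w)\<close>, \<open>N (w C) = 0\<close> and \<open>N = 1\<close> for the empty
  word it determines \<open>N\<close> (lemmas \<open>card_dumont_words_exchange\<close> and \<open>card_dumont_words\<close>).

  The transfer recursion satisfies the same rules, although this is not visible blockwise. The key
  is the identity \<open>completions_Suc_closed\<close>, which trades a closed block for an open one.
\<close>

section \<open>The common count\<close>

text \<open>
  The number of ways to extend \<open>p\<close> open blocks (columns only) and \<open>q\<close> closed blocks (columns and
  rows) along the word \<open>w\<close> until no block is open, counted with the orderings of the final
  blocks.
\<close>
fun completions :: "bool list \<Rightarrow> nat \<Rightarrow> nat \<Rightarrow> nat" where
  "completions [] p q = (if p = 0 then fact q else 0)"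
| "completions (False # w) p q = p * completions w p q + completions w (Suc p) q"
| "completions (True # w) p q = Suc q * completions w p q + p * completions w (p - 1) (Suc q)"

text \<open>
  Let \<open>A\<close> be the operator of a column letter on functions of \<open>p\<close>. The values for \<open>q\<close> closed
  blocks arise from those for \<open>0\<close> closed blocks by applying
  \<open>(A + 1) (A + 2) \<dots> (A + q)\<close>; the lemma is one factor of this product.
\<close>
lemma completions_Suc_closed:
  "completions w p (Suc q) = (p + q + 1) * completions w p q + completions w (Suc p) q"
proof (induction w arbitrary: p q)
  case Nil
  show ?case by simp
next
  case (Cons b w)
  show ?case
  proof (cases b)
    case False
    then show ?thesis by (simp add: Cons.IH algebra_simps)
  next
    case True
    show ?thesis
    proof (cases p)
      case 0
      with True show ?thesis by (simp add: Cons.IH algebra_simps)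
    next
      case (Suc p')
      with True show ?thesis
        using Suc Cons.IH[of p q] Cons.IH[of p' "Suc q"]
        by (simp add: algebra_simps)
    qed
  qed
qed

text \<open>
  The commutation rule between the operators of the two letters. The commutator of their
  transfer steps contains a term with one more closed block, which \<open>completions_Suc_closed\<close> turns
  into the two shorter words. The rule holds for every state, hence it survives any prefix
  \<open>u\<close>.
\<close>
lemma completions_exchange:
  "completions (u @ False # True # v) p q =
     completions (u @ True # False # v) p q
     + completions (u @ False # v) p q + completions (u @ True # v) p q"
proof (induction u arbitrary: p q)
  case Nil
  show ?case by (cases p) (simp_all add: completions_Suc_closed algebra_simps)
next
  case (Cons b u)
  show ?case by (cases b) (simp_all add: Cons.IH algebra_simps)
qed

text \<open>
  The block of a column that is read last never receives a row.
\<close>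
lemma completions_last_column: "completions (w @ [False]) p q = 0"
proof (induction w arbitrary: p q)
  case (Cons b w)
  then show ?case by (cases b) simp_all
qed simp

section \<open>Words with prescribed ascent bottoms\<close>

lemma ascent_bottoms_Nil [simp]: "ascent_bottoms [] = {}"
  and ascent_bottoms_single [simp]: "ascent_bottoms [x] = {}"
  by (simp_all add: ascent_bottoms_def)

lemma ascent_bottoms_Cons:
  "ascent_bottoms (x # y # ys) = (if x < y then {x} else {}) \<union> ascent_bottoms (y # ys)"
proof (intro set_eqI iffI)
  fix z
  assume "z \<in> ascent_bottoms (x # y # ys)"
  then obtain i where "Suc i < length (x # y # ys)" "(x # y # ys) ! i = z"
      "z < (x # y # ys) ! Suc i"
    by (auto simp: ascent_bottoms_def)
  then show "z \<in> (if x < y then {x} else {}) \<union> ascent_bottoms (y # ys)"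
    by (cases i) (auto simp: ascent_bottoms_def)
next
  fix z
  assume "z \<in> (if x < y then {x} else {}) \<union> ascent_bottoms (y # ys)"
  then consider "z = x" "x < y" | i where "Suc i < length (y # ys)" "(y # ys) ! i = z"
      "z < (y # ys) ! Suc i"
    by (auto simp: ascent_bottoms_def split: if_splits)
  then show "z \<in> ascent_bottoms (x # y # ys)"
  proof cases
    case 1
    then show ?thesis by (force simp: ascent_bottoms_def intro: exI[of _ 0])
  next
    case 2
    then show ?thesis by (force simp: ascent_bottoms_def intro: exI[of _ "Suc i"])
  qed
qed

lemma ascent_bottoms_subset: "ascent_bottoms xs \<subseteq> set xs"
  by (auto simp: ascent_bottoms_def)

lemma ascent_bottoms_append:
  "ascent_bottoms (xs @ a # ys) = ascent_bottoms (xs @ [a]) \<union> ascent_bottoms (a # ys)"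
proof (induction xs)
  case (Cons x xs)
  then show ?case by (cases xs) (auto simp: ascent_bottoms_Cons)
qed simp

lemma ascent_bottoms_snoc_cong:
  assumes "\<And>x. x \<in> set xs \<Longrightarrow> x < a \<longleftrightarrow> x < b"
  shows "ascent_bottoms (xs @ [a]) = ascent_bottoms (xs @ [b])"
proof (cases xs rule: rev_cases)
  case (snoc us y)
  then show ?thesis
    using assms by (simp add: ascent_bottoms_append[of us y "[a]"] ascent_bottoms_append[of us y "[b]"]
      ascent_bottoms_Cons)
qed simp

definition immediately_before :: "'a \<Rightarrow> 'a \<Rightarrow> 'a list \<Rightarrow> bool" where
  "immediately_before z k d \<longleftrightarrow> (\<exists>us vs. d = us @ z # k # vs)"

lemma immediately_before_nth:
  assumes "Suc i < length d"
  shows "immediately_before (d ! i) (d ! Suc i) d"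
proof -
  have "d = take i d @ d ! i # drop (Suc i) d" using assms by (intro id_take_nth_drop) simp
  also have "drop (Suc i) d = d ! Suc i # drop (Suc (Suc i)) d"
    using assms by (rule Cons_nth_drop_Suc[symmetric])
  finally show ?thesis unfolding immediately_before_def by blast
qed

lemma immediately_before_asym:
  assumes "distinct d" "immediately_before a b d"
  shows "\<not> immediately_before b a d"
proof
  assume "immediately_before b a d"
  then obtain us' vs' where d': "d = us' @ b # a # vs'"
    unfolding immediately_before_def by blast
  obtain us vs where d: "d = us @ a # b # vs"
    using assms(2) unfolding immediately_before_def by blast
  have fresh: "b \<notin> set (us @ [a])" "b \<notin> set vs" "a \<notin> set vs"
    using assms(1) unfolding d by auto
  have "us @ a # b # vs = us' @ b # a # vs'" by (rule trans[OF d[symmetric] d'])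
  then have "(us @ [a]) @ b # vs = us' @ b # (a # vs')" by (simp only: append.simps append_assoc)
  then have "vs = a # vs'" using append_Cons_eq_iff[OF fresh(1,2)] by blast
  then show False using fresh(3) by simp
qed

lemma immediately_before_ascent:
  assumes "distinct d" "immediately_before a b d"
  shows "a \<in> ascent_bottoms d \<longleftrightarrow> a < b"
proof -
  obtain us vs where d: "d = us @ a # b # vs"
    using assms(2) unfolding immediately_before_def by blast
  let ?k = "length us"
  have len: "Suc ?k < length d" "d ! ?k = a" "d ! Suc ?k = b"
    by (simp_all add: d nth_append)
  have unique: "i = ?k" if "Suc i < length d" "a = d ! i" for i
  proof -
    have "d ! i = d ! ?k" using that(2) len(2) by metis
    then show ?thesis using that(1) len(1) nth_eq_iff_index_eq[OF assms(1)] by (meson Suc_lessD)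
  qed
  show ?thesis
  proof
    assume "a \<in> ascent_bottoms d"
    then obtain i where i: "a = d ! i" "Suc i < length d" "d ! i < d ! Suc i"
      unfolding ascent_bottoms_def by blast
    have "i = ?k" by (rule unique[OF i(2,1)])
    with i(3) len(2,3) show "a < b" by simp
  next
    assume "a < b"
    with len have "d ! ?k < d ! Suc ?k" by simp
    with len(1,2) show "a \<in> ascent_bottoms d" unfolding ascent_bottoms_def by blast
  qed
qed

text \<open>
  Contraction of an adjacent pair: \<open>z\<close> can be put back in one way, immediately before \<open>k\<close>.
  All three recursive steps that delete a letter are instances.
\<close>
lemma card_delete_before:
  assumes D: "\<And>d. d \<in> D \<Longrightarrow> distinct d"
    and D': "\<And>d. d \<in> D' \<Longrightarrow> distinct d \<and> k \<in> set d \<and> z \<notin> set d"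
    and iff: "\<And>us vs. distinct (us @ z # k # vs) \<Longrightarrow>
                us @ z # k # vs \<in> D \<longleftrightarrow> us @ k # vs \<in> D'"
  shows "card {d \<in> D. immediately_before z k d} = card D'"
proof (rule bij_betw_same_card)
  let ?E = "{d \<in> D. immediately_before z k d}"
  let ?f = "filter (\<lambda>x. x \<noteq> z)"
  have ex: "\<exists>us vs. d = us @ z # k # vs \<and> ?f d = us @ k # vs \<and> distinct d" if "d \<in> ?E" for d
  proof -
    obtain us vs where d: "d = us @ z # k # vs"
      using \<open>d \<in> ?E\<close> unfolding immediately_before_def by blast
    have "distinct d" using that D by blast
    with d have "?f us = us" "?f vs = vs" "z \<noteq> k"
      by (auto simp: filter_id_conv)
    then show ?thesis using d \<open>distinct d\<close> by auto
  qed
  show "bij_betw ?f ?E D'"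
  proof (rule bij_betwI')
    fix d e
    assume "d \<in> ?E" "e \<in> ?E"
    then obtain us vs us' vs'
      where d: "d = us @ z # k # vs" "?f d = us @ k # vs" "distinct d"
        and e: "e = us' @ z # k # vs'" "?f e = us' @ k # vs'" "distinct e"
      using ex[of d] ex[of e] by auto
    then show "?f d = ?f e \<longleftrightarrow> d = e"
      by (auto simp: append_Cons_eq_iff)
  next
    fix d
    assume "d \<in> ?E"
    then show "?f d \<in> D'" using ex[of d] iff by fastforce
  next
    fix e
    assume e: "e \<in> D'"
    then obtain us vs where us: "e = us @ k # vs" using D' by (meson split_list)
    then have "distinct (us @ z # k # vs)" using D'[OF e] by auto
    then have "us @ z # k # vs \<in> ?E" "?f us = us" "?f vs = vs" "z \<noteq> k"
      using iff e us by (auto simp: immediately_before_def filter_id_conv)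
    then show "\<exists>d\<in>?E. e = ?f d"
      using us by (intro bexI[of _ "us @ z # k # vs"]) auto
  qed
qed

definition dumont_words :: "nat set \<Rightarrow> nat set \<Rightarrow> nat \<Rightarrow> nat list set" where
  "dumont_words X R m =
     {d. distinct d \<and> set d = insert m X \<and> last d = m \<and> ascent_bottoms d = R}"

lemma finite_dumont_words: "finite X \<Longrightarrow> finite (dumont_words X R m)"
  by (rule finite_subset[OF _ finite_permutations_of_set[of "insert m X"]])
    (auto simp: dumont_words_def permutations_of_set_def)

lemma dumont_words_empty: "dumont_words {} {} m = {[m]}"
proof -
  have "d = [m]" if d: "distinct d" "set d = {m}" for d
  proof -
    have "length d = card {m}" using distinct_card[OF d(1)] unfolding d(2) by (rule sym)
    then obtain y where "d = [y]" by (cases d) auto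
    with d(2) show ?thesis by simp
  qed
  then show ?thesis by (auto simp: dumont_words_def)
qed

lemma card_dumont_words_delete:
  assumes z: "z \<notin> X" "z \<noteq> m" and k: "k \<in> insert m X"
    and ascents: "\<And>us vs. distinct (us @ z # k # vs) \<Longrightarrow> set (us @ k # vs) = insert m X \<Longrightarrow>
      ascent_bottoms (us @ z # k # vs) = R' \<longleftrightarrow> ascent_bottoms (us @ k # vs) = R"
  shows "card {d \<in> dumont_words (insert z X) R' m. immediately_before z k d} =
         card (dumont_words X R m)"
proof (rule card_delete_before)
  fix us vs
  assume dist: "distinct (us @ z # k # vs)"
  let ?d = "us @ z # k # vs" and ?e = "us @ k # vs"
  have "set ?d = insert z (set ?e)" "z \<notin> set ?e" "z \<notin> insert m X" "distinct ?e"
    using dist z by auto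
  then have "set ?d = insert m (insert z X) \<longleftrightarrow> set ?e = insert m X"
    by (metis insert_commute insert_ident)
  moreover have "last ?d = last ?e" by simp
  ultimately show "?d \<in> dumont_words (insert z X) R' m \<longleftrightarrow> ?e \<in> dumont_words X R m"
    unfolding dumont_words_def mem_Collect_eq
    using ascents[OF dist] dist \<open>distinct ?e\<close> by metis
qed (use z k in \<open>auto simp: dumont_words_def\<close>)

text \<open>
  An ascent from the largest label can only lead to \<open>m\<close>, so the label stands immediately before
  \<open>m\<close> and can be deleted.
\<close>
lemma card_dumont_words_top_row:
  assumes "x \<notin> X" "\<And>y. y \<in> X \<Longrightarrow> y < x" "x < m" "R \<subseteq> X"
  shows "card (dumont_words (insert x X) (insert x R) m) = card (dumont_words X R m)"
proof -
  have "immediately_before x m d" if d: "d \<in> dumont_words (insert x X) (insert x R) m" for d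
  proof -
    have "x \<in> ascent_bottoms d" using d by (auto simp: dumont_words_def)
    then obtain i where i: "Suc i < length d" "d ! i = x" "x < d ! Suc i"
      by (auto simp: ascent_bottoms_def)
    have "d ! Suc i \<in> insert m (insert x X)"
      using i d nth_mem by (fastforce simp: dumont_words_def)
    with i assms(2) have "d ! Suc i = m" by fastforce
    then show ?thesis using immediately_before_nth[OF i(1)] i(2) by simp
  qed
  then have "card (dumont_words (insert x X) (insert x R) m) =
      card {d \<in> dumont_words (insert x X) (insert x R) m. immediately_before x m d}"
    by (intro arg_cong[where f = card]) auto
  also have "\<dots> = card (dumont_words X R m)"
  proof (rule card_dumont_words_delete)
    fix us vs
    assume dist: "distinct (us @ x # m # vs)" and X: "set (us @ m # vs) = insert m X"
    let ?e = "us @ m # vs"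
    have "ascent_bottoms (us @ [x]) = ascent_bottoms (us @ [m])"
    proof (rule ascent_bottoms_snoc_cong)
      fix y assume "y \<in> set us"
      then have "y \<in> X" using X dist by auto
      then show "y < x \<longleftrightarrow> y < m" using assms(2)[of y] assms(3) by auto
    qed
    then have "ascent_bottoms (us @ x # m # vs) = insert x (ascent_bottoms ?e)"
      using assms(3)
      by (simp add: ascent_bottoms_append[of us x "m # vs"] ascent_bottoms_append[of us m vs]
            ascent_bottoms_Cons)
    moreover have "x \<notin> ascent_bottoms ?e" using dist ascent_bottoms_subset[of ?e] by auto
    moreover have "x \<notin> R" using assms(1,4) by auto
    ultimately show "ascent_bottoms (us @ x # m # vs) = insert x R \<longleftrightarrow> ascent_bottoms ?e = R"
      by (simp add: insert_ident)
  qed (use assms in auto)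
  finally show ?thesis .
qed

text \<open>
  The smallest letter is always followed by a larger one, because it is not the last letter
  \<open>m\<close>.
\<close>
lemma dumont_words_bottom_column:
  assumes "x \<in> X" "x \<notin> R" "\<And>y. y \<in> X \<Longrightarrow> x \<le> y" "x < m"
  shows "dumont_words X R m = {}"
proof -
  have False if d: "d \<in> dumont_words X R m" for d
  proof -
    have "x \<in> set d" using d assms(1) by (auto simp: dumont_words_def)
    then obtain us vs where us: "d = us @ x # vs" by (meson split_list)
    then obtain y ws where vs: "vs = y # ws"
      using d assms(4) by (cases vs) (auto simp: dumont_words_def)
    have "y \<in> insert m X" "y \<noteq> x" using d us vs by (auto simp: dumont_words_def)
    then have "x < y" using assms(3,4) by force
    then have "x \<in> ascent_bottoms d"
      by (simp add: us vs ascent_bottoms_append[of us x "y # ws"] ascent_bottoms_Cons)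
    then show False using d assms(2) by (auto simp: dumont_words_def)
  qed
  then show ?thesis by blast
qed

text \<open>
  Exchanging two letters of neighbouring values changes no comparison except the one between
  themselves.
\<close>
lemma ascent_bottoms_map_transpose:
  fixes r c :: nat
  assumes near: "\<And>x. x \<in> set d - {r, c} \<Longrightarrow> x < r \<longleftrightarrow> x < c"
    and apart: "\<not> immediately_before r c d" "\<not> immediately_before c r d"
  shows "ascent_bottoms (map (transpose r c) d) = transpose r c ` ascent_bottoms d"
proof -
  let ?t = "transpose r c"
  have same: "?t (d ! i) < ?t (d ! Suc i) \<longleftrightarrow> d ! i < d ! Suc i" if i: "Suc i < length d" for i
  proof -
    define x y where "x = d ! i" and "y = d ! Suc i"
    have "\<not> (x = r \<and> y = c)" "\<not> (x = c \<and> y = r)"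
      using apart immediately_before_nth[OF i] unfolding x_def y_def by metis+
    moreover have "x \<in> set d" "y \<in> set d" using i by (auto simp: x_def y_def)
    then have "x = r \<or> x = c \<or> (x < r \<longleftrightarrow> x < c)" "y = r \<or> y = c \<or> (y < r \<longleftrightarrow> y < c)"
      using near by blast+
    ultimately have "?t x < ?t y \<longleftrightarrow> x < y"
      unfolding transpose_def by (smt (verit) linorder_neqE_nat not_less_iff_gr_or_eq)
    then show ?thesis by (simp add: x_def y_def)
  qed
  have image: "ascent_bottoms e = (!) e ` {i. Suc i < length e \<and> e ! i < e ! Suc i}"
    for e :: "nat list"
    unfolding ascent_bottoms_def by blast
  have positions: "{i. Suc i < length (map ?t d) \<and> map ?t d ! i < map ?t d ! Suc i} =
      {i. Suc i < length d \<and> d ! i < d ! Suc i}"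
    using same by (intro Collect_cong) auto
  show ?thesis
    unfolding image[of d] image[of "map ?t d"] positions image_image
    by (intro image_cong) auto
qed

lemma immediately_before_map:
  assumes "inj f"
  shows "immediately_before (f a) (f b) (map f d) \<longleftrightarrow> immediately_before a b d"
proof
  assume "immediately_before (f a) (f b) (map f d)"
  then obtain us vs where "map f d = us @ f a # f b # vs"
    by (auto simp: immediately_before_def)
  then obtain us' w where d: "d = us' @ w" and "map f w = f a # f b # vs"
    by (auto simp: map_eq_append_conv)
  then obtain x y vs' where w: "w = x # y # vs'" and "f x = f a" "f y = f b"
    by (auto simp: map_eq_Cons_conv)
  then have "x = a" "y = b" using assms by (auto dest: injD)
  then show "immediately_before a b d" using d w by (auto simp: immediately_before_def)
next
  assume "immediately_before a b d"
  then obtain us vs where "d = us @ a # b # vs" by (auto simp: immediately_before_def)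
  then have "map f d = map f us @ f a # f b # map f vs" by simp
  then show "immediately_before (f a) (f b) (map f d)" unfolding immediately_before_def by blast
qed

text \<open>
  The three summands are the words in which \<open>r\<close> and \<open>c\<close> are apart (exchange them), in which
  \<open>r c\<close> occurs (delete \<open>r\<close>), and in which \<open>c r\<close> occurs (delete \<open>c\<close>). In the exchanged
  labelling \<open>r\<close> is not an ascent bottom and \<open>c\<close> is one, so the two letters are never adjacent
  there and the exchange reaches every word.
\<close>
lemma card_dumont_words_exchange:
  assumes X: "finite X" "r \<notin> X" "c \<notin> X" "\<And>x. x \<in> X \<Longrightarrow> x < r \<longleftrightarrow> x < c"
    and rc: "r < c" "c < m" and R: "R \<subseteq> X"
  shows "card (dumont_words (insert r (insert c X)) (insert r R) m) =
      card (dumont_words (insert r (insert c X)) (insert c R) m)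
      + card (dumont_words (insert c X) R m)
      + card (dumont_words (insert r X) (insert r R) m)"
proof -
  define D where "D = dumont_words (insert r (insert c X)) (insert r R) m"
  define E where "E = dumont_words (insert r (insert c X)) (insert c R) m"
  define F where "F = {d \<in> D. \<not> immediately_before r c d \<and> \<not> immediately_before c r d}"
  have fin: "finite D" unfolding D_def using X by (intro finite_dumont_words) auto
  have near: "x < r \<longleftrightarrow> x < c" if "x \<in> insert m X" for x using that X(4) rc by auto
  have notin: "r \<notin> R" "c \<notin> R" using X R by auto
  have snoc: "ascent_bottoms (us @ [r]) = ascent_bottoms (us @ [c])"
    if "set us \<subseteq> insert m X" for us
    using near that by (intro ascent_bottoms_snoc_cong) auto
  have split: "card D = card {d \<in> D. immediately_before r c d}
      + card {d \<in> D. immediately_before c r d} + card F"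
  proof -
    let ?A = "{d \<in> D. immediately_before r c d}" and ?B = "{d \<in> D. immediately_before c r d}"
    have "?A \<inter> ?B = {}"
      using immediately_before_asym[of _ r c] by (auto simp: D_def dumont_words_def)
    then have "card (?A \<union> ?B) = card ?A + card ?B" using fin by (simp add: card_Un_disjoint)
    moreover have "card (?A \<union> ?B \<union> F) = card (?A \<union> ?B) + card F"
      using fin by (intro card_Un_disjoint) (auto simp: F_def)
    moreover have "?A \<union> ?B \<union> F = D" by (auto simp: F_def)
    ultimately show ?thesis by simp
  qed
  have row: "card {d \<in> D. immediately_before r c d} = card (dumont_words (insert c X) R m)"
    unfolding D_def
  proof (rule card_dumont_words_delete)
    fix us vs
    assume dist: "distinct (us @ r # c # vs)" and set: "set (us @ c # vs) = insert m (insert c X)"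
    let ?e = "us @ c # vs"
    have "set us \<subseteq> insert m X" using dist set by auto
    from snoc[OF this] have "ascent_bottoms (us @ r # c # vs) = insert r (ascent_bottoms ?e)"
      using rc by (simp add: ascent_bottoms_append[of us r "c # vs"]
          ascent_bottoms_append[of us c vs] ascent_bottoms_Cons)
    moreover have "r \<notin> ascent_bottoms ?e" using dist ascent_bottoms_subset[of ?e] by auto
    ultimately show "ascent_bottoms (us @ r # c # vs) = insert r R \<longleftrightarrow> ascent_bottoms ?e = R"
      using notin by (simp add: insert_ident)
  qed (use X(2,3) rc in auto)
  have column: "card {d \<in> D. immediately_before c r d} =
      card (dumont_words (insert r X) (insert r R) m)"
    unfolding D_def insert_commute[of r c X]
  proof (rule card_dumont_words_delete)
    fix us vs
    assume dist: "distinct (us @ c # r # vs)" and set: "set (us @ r # vs) = insert m (insert r X)"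
    have "set us \<subseteq> insert m X" using dist set by auto
    from snoc[OF this] have "ascent_bottoms (us @ c # r # vs) = ascent_bottoms (us @ r # vs)"
      using rc by (simp add: ascent_bottoms_append[of us c "r # vs"]
          ascent_bottoms_append[of us r vs] ascent_bottoms_Cons)
    then show "ascent_bottoms (us @ c # r # vs) = insert r R \<longleftrightarrow>
        ascent_bottoms (us @ r # vs) = insert r R"
      by simp
  qed (use X(2,3) rc in auto)
  have swap: "card F = card E"
  proof (rule bij_betw_same_card)
    let ?t = "transpose r c"
    have t_inj: "inj ?t" by (rule inj_on_inverseI[of _ ?t]) simp
    have t_set: "?t ` insert m (insert r (insert c X)) = insert m (insert r (insert c X))"
      by (rule transpose_image_eq) simp
    have "?t ` R = R" using notin by (intro transpose_image_eq) simp
    then have t_R: "?t ` insert r R = insert c R" "?t ` insert c R = insert r R"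
      by simp_all
    have t_m: "?t m = m" using rc by (simp add: transpose_def)
    have move: "map ?t d \<in> dumont_words (insert r (insert c X)) (?t ` S) m"
      if d: "d \<in> dumont_words (insert r (insert c X)) S m"
        and apart: "\<not> immediately_before r c d" "\<not> immediately_before c r d" for d S
    proof -
      have set: "set d = insert m (insert r (insert c X))" and "d \<noteq> []"
        and d': "distinct d" "last d = m" "ascent_bottoms d = S"
        using d by (auto simp: dumont_words_def)
      have "ascent_bottoms (map ?t d) = ?t ` S"
        using ascent_bottoms_map_transpose[OF _ apart] near set d'(3) by auto
      moreover have "last (map ?t d) = m"
        using \<open>d \<noteq> []\<close> d'(2) t_m by (simp add: last_map)
      moreover have "set (map ?t d) = insert m (insert r (insert c X))"
        using t_set set by simp
      moreover have "distinct (map ?t d)"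
        using d'(1) by (simp add: distinct_map inj_on_inverseI[of _ ?t ?t])
      ultimately show ?thesis by (simp add: dumont_words_def)
    qed
    have E_apart: "\<not> immediately_before r c d \<and> \<not> immediately_before c r d" if "d \<in> E" for d
    proof -
      have asc: "ascent_bottoms d = insert c R" using that by (simp add: E_def dumont_words_def)
      have "r \<notin> ascent_bottoms d" "c \<in> ascent_bottoms d" using asc notin rc by auto
      moreover have "distinct d" using that by (simp add: E_def dumont_words_def)
      ultimately show ?thesis
        using immediately_before_ascent[of d] rc by (metis less_asym)
    qed
    show "bij_betw (map ?t) F E"
    proof (rule bij_betw_byWitness[where f' = "map ?t"])
      show "map ?t ` F \<subseteq> E"
        using move[of _ "insert r R"] unfolding F_def D_def E_def t_R by blast
      show "map ?t ` E \<subseteq> F"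
      proof (intro image_subsetI)
        fix d assume d: "d \<in> E"
        have "map ?t d \<in> D"
          using move[of d "insert c R"] d E_apart[OF d] unfolding D_def E_def t_R by blast
        moreover have "\<not> immediately_before r c (map ?t d)" "\<not> immediately_before c r (map ?t d)"
          using E_apart[OF d] immediately_before_map[OF t_inj, of c r d]
            immediately_before_map[OF t_inj, of r c d] by simp_all
        ultimately show "map ?t d \<in> F" by (simp add: F_def)
      qed
    qed (auto simp: o_def)
  qed
  show ?thesis using split row column swap unfolding D_def E_def by simp
qed

text \<open>
  A word that starts with a column and ends with a row has a column directly followed by a row,
  so the boundary rules and the exchange rule cover all words. The exchange replaces the
  column \<open>c\<close> by the smaller column \<open>r\<close>, and deletions shorten the word; hence the sum of the
  column labels plus the length is a termination measure.
\<close>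
theorem card_dumont_words:
  assumes "sorted_wrt (>) xs" "\<And>x. x \<in> set xs \<Longrightarrow> x < m"
  shows "card (dumont_words (set xs) (R \<inter> set xs) m) = completions (map (\<lambda>x. x \<in> R) xs) 0 0"
  using assms
proof (induction "\<Sum>(set xs - R) + length xs" arbitrary: xs R rule: less_induct)
  case less
  note sorted = less.prems(1) and bound = less.prems(2)
  consider "xs = []"
    | x ys where "xs = x # ys" "x \<in> R"
    | us z where "xs = us @ [z]" "z \<notin> R"
    | us c r vs where "xs = us @ c # r # vs" "c \<notin> R" "r \<in> R"
  proof -
    consider "xs = []" | "xs \<noteq> []" "hd xs \<in> R" | "xs \<noteq> []" "last xs \<notin> R"
      | "xs \<noteq> []" "hd xs \<notin> R" "last xs \<in> R"
      by blast
    then show ?thesis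
    proof cases
      case 2
      then show ?thesis using that(2)[of "hd xs" "tl xs"] by simp
    next
      case 3
      then show ?thesis using that(3)[of "butlast xs" "last xs"] by simp
    next
      case 4
      then have "\<exists>x\<in>set xs. x \<in> R" by (meson last_in_set)
      then obtain us r vs where us: "xs = us @ r # vs" "r \<in> R" "\<forall>x\<in>set us. x \<notin> R"
        using split_list_first_prop[of xs "\<lambda>x. x \<in> R"] by blast
      moreover have "us \<noteq> []" using us 4(2) by (cases us) auto
      ultimately show ?thesis
        using that(4)[of "butlast us" "last us" r vs] by simp
    qed (rule that(1))
  qed
  then show ?case
  proof cases
    case 1
    then show ?thesis by (simp add: dumont_words_empty)
  next
    case 2
    have "x \<notin> set ys" "\<And>y. y \<in> set ys \<Longrightarrow> y < x" using sorted 2 by auto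
    moreover have "R \<inter> set xs = insert x (R \<inter> set ys)" "set xs = insert x (set ys)"
      using 2 by auto
    ultimately have "card (dumont_words (set xs) (R \<inter> set xs) m) =
        card (dumont_words (set ys) (R \<inter> set ys) m)"
      using card_dumont_words_top_row[of x "set ys" m "R \<inter> set ys"] bound 2 by simp
    also have "\<dots> = completions (map (\<lambda>x. x \<in> R) ys) 0 0"
    proof (rule less.hyps)
      have "set ys - R = set xs - R" using 2 by auto
      then show "\<Sum>(set ys - R) + length ys < \<Sum>(set xs - R) + length xs" using 2 by simp
    qed (use sorted bound 2 in auto)
    finally show ?thesis using 2 by simp
  next
    case 3
    have "dumont_words (set xs) (R \<inter> set xs) m = {}"
      using 3 sorted bound
      by (intro dumont_words_bottom_column[of z]) (auto simp: sorted_wrt_append less_imp_le)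
    then show ?thesis using 3 by (simp add: completions_last_column)
  next
    case 4
    define X where "X = set us \<union> set vs"
    have sets: "set xs = insert r (insert c X)" using 4 by (auto simp: X_def)
    have X: "finite X" "r \<notin> X" "c \<notin> X" "r < c" "c < m"
      using sorted bound 4 by (auto simp: X_def sorted_wrt_append)
    have near: "x < r \<longleftrightarrow> x < c" if "x \<in> X" for x
      using that sorted 4 by (fastforce simp: X_def sorted_wrt_append)
    let ?w = "\<lambda>R xs. map (\<lambda>x. x \<in> R) xs"
    let ?R = "insert c (R - {r})"
    have "R \<inter> set xs = insert r (R \<inter> X)" using sets 4 by auto
    with card_dumont_words_exchange[OF X(1-3) near X(4,5), of "R \<inter> X"]
    have "card (dumont_words (set xs) (R \<inter> set xs) m) =
        card (dumont_words (set xs) (insert c (R \<inter> X)) m)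
        + card (dumont_words (insert c X) (R \<inter> X) m)
        + card (dumont_words (insert r X) (insert r (R \<inter> X)) m)"
      by (simp add: sets)
    also have "card (dumont_words (set xs) (insert c (R \<inter> X)) m) = completions (?w ?R xs) 0 0"
    proof -
      have "insert c (R \<inter> X) = ?R \<inter> set xs" using sets X by auto
      moreover have "card (dumont_words (set xs) (?R \<inter> set xs) m) = completions (?w ?R xs) 0 0"
      proof (rule less.hyps)
        have "set xs - R = insert c (X - R)" "set xs - ?R = insert r (X - R)"
          using sets X 4 by auto
        then show "\<Sum>(set xs - ?R) + length xs < \<Sum>(set xs - R) + length xs"
          using X by simp
      qed (use sorted bound in auto)
      ultimately show ?thesis by simp
    qed
    also have "card (dumont_words (insert c X) (R \<inter> X) m) = completions (?w R (us @ c # vs)) 0 0"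
    proof -
      have "insert c X = set (us @ c # vs)" "R \<inter> X = R \<inter> set (us @ c # vs)"
        using 4 by (auto simp: X_def)
      moreover have "card (dumont_words (set (us @ c # vs)) (R \<inter> set (us @ c # vs)) m) =
          completions (?w R (us @ c # vs)) 0 0"
      proof (rule less.hyps)
        have "set (us @ c # vs) - R = set xs - R" using 4 by auto
        then show "\<Sum>(set (us @ c # vs) - R) + length (us @ c # vs) < \<Sum>(set xs - R) + length xs"
          using 4 by simp
      qed (use sorted bound 4 in \<open>auto simp: sorted_wrt_append\<close>)
      ultimately show ?thesis by simp
    qed
    also have "card (dumont_words (insert r X) (insert r (R \<inter> X)) m) =
        completions (?w R (us @ r # vs)) 0 0"
    proof -
      have "insert r X = set (us @ r # vs)" "insert r (R \<inter> X) = R \<inter> set (us @ r # vs)"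
        using 4 by (auto simp: X_def)
      moreover have "card (dumont_words (set (us @ r # vs)) (R \<inter> set (us @ r # vs)) m) =
          completions (?w R (us @ r # vs)) 0 0"
      proof (rule less.hyps)
        have "\<Sum>(set (us @ r # vs) - R) \<le> \<Sum>(set xs - R)"
          using 4 by (intro sum_mono2) auto
        then show "\<Sum>(set (us @ r # vs) - R) + length (us @ r # vs) < \<Sum>(set xs - R) + length xs"
          using 4 by simp
      qed (use sorted bound 4 in \<open>auto simp: sorted_wrt_append\<close>)
      ultimately show ?thesis by simp
    qed
    also have "?w ?R xs = ?w R us @ True # False # ?w R vs"
      using 4 X by (auto simp: X_def)
    finally show ?thesis
      using 4 completions_exchange[of "?w R us" "?w R vs" 0 0] by simp
  qed
qed

section \<open>Colourings of the labels\<close>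

text \<open>
  The variant of \<open>completions\<close> that counts each final configuration once, and only those with
  exactly \<open>m\<close> blocks.
\<close>
fun sized_completions :: "nat \<Rightarrow> bool list \<Rightarrow> nat \<Rightarrow> nat \<Rightarrow> nat" where
  "sized_completions m [] p q = (if p = 0 \<and> q = m then 1 else 0)"
| "sized_completions m (False # w) p q =
     p * sized_completions m w p q + sized_completions m w (Suc p) q"
| "sized_completions m (True # w) p q =
     Suc q * sized_completions m w p q + p * sized_completions m w (p - 1) (Suc q)"

lemma completions_eq_sum_sized:
  assumes "p + q + length w \<le> M"
  shows "completions w p q = (\<Sum>m\<le>M. fact m * sized_completions m w p q)"
  using assms
proof (induction w arbitrary: p q)
  case Nil
  have "(\<Sum>m\<le>M. fact m * sized_completions m [] p q) =
      (\<Sum>m\<le>M. if m = q then (if p = 0 then fact q else 0) else 0)"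
    by (intro sum.cong) auto
  then show ?case using Nil by simp
next
  case (Cons b w)
  have step: "completions w p q = (\<Sum>m\<le>M. fact m * sized_completions m w p q)"
    using Cons by simp
  show ?case
  proof (cases b)
    case False
    have "completions w (Suc p) q = (\<Sum>m\<le>M. fact m * sized_completions m w (Suc p) q)"
      using Cons.prems by (intro Cons.IH) simp
    with step False show ?thesis
      by (simp add: distrib_left sum.distrib sum_distrib_left mult.left_commute)
  next
    case True
    have "p * completions w (p - 1) (Suc q) =
        p * (\<Sum>m\<le>M. fact m * sized_completions m w (p - 1) (Suc q))"
    proof (cases p)
      case (Suc p')
      then show ?thesis using Cons.prems Cons.IH[of p' "Suc q"] by simp
    qed simp
    with step True show ?thesis
      by (simp add: distrib_left sum.distrib sum_distrib_left mult.left_commute)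
  qed
qed

text \<open>
  A map \<open>h\<close> sends a label to the number of its block, with \<open>None\<close> for unused rows. The sets
  \<open>N\<close>, \<open>P\<close> and \<open>Q\<close> hold the numbers of the blocks that are untouched, open and closed by the
  labels larger than all of \<open>R\<close> and \<open>C\<close>: an untouched block needs a column and a row
  from \<open>C\<close> and \<open>R\<close>, an open block needs a row, and a closed block admits no further column.
\<close>
definition colourings ::
    "nat set \<Rightarrow> nat set \<Rightarrow> nat set \<Rightarrow> nat set \<Rightarrow> nat set \<Rightarrow> (nat \<rightharpoonup> nat) set" where
  "colourings R C N P Q =
     {h. dom h \<subseteq> R \<union> C
       \<and> (\<forall>c\<in>C. \<exists>j\<in>N \<union> P. h c = Some j)
       \<and> (\<forall>r\<in>R. \<forall>j. h r = Some j \<longrightarrow> j \<in> N \<union> P \<union> Q)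
       \<and> (\<forall>r\<in>R. \<forall>c\<in>C. h r = h c \<longrightarrow> r < c)
       \<and> (\<forall>j\<in>N. \<exists>c\<in>C. h c = Some j)
       \<and> (\<forall>j\<in>N \<union> P. \<exists>r\<in>R. h r = Some j)}"

lemma colouringsI:
  assumes "dom h \<subseteq> R \<union> C"
    and "\<And>c. c \<in> C \<Longrightarrow> \<exists>j\<in>N \<union> P. h c = Some j"
    and "\<And>r j. r \<in> R \<Longrightarrow> h r = Some j \<Longrightarrow> j \<in> N \<union> P \<union> Q"
    and "\<And>r c. r \<in> R \<Longrightarrow> c \<in> C \<Longrightarrow> h r = h c \<Longrightarrow> r < c"
    and "\<And>j. j \<in> N \<Longrightarrow> \<exists>c\<in>C. h c = Some j"
    and "\<And>j. j \<in> N \<union> P \<Longrightarrow> \<exists>r\<in>R. h r = Some j"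
  shows "h \<in> colourings R C N P Q"
  unfolding colourings_def mem_Collect_eq using assms by simp

lemma colouringsD:
  assumes "h \<in> colourings R C N P Q"
  shows "dom h \<subseteq> R \<union> C"
    and "c \<in> C \<Longrightarrow> \<exists>j\<in>N \<union> P. h c = Some j"
    and "r \<in> R \<Longrightarrow> h r = Some j \<Longrightarrow> j \<in> N \<union> P \<union> Q"
    and "r \<in> R \<Longrightarrow> c \<in> C \<Longrightarrow> h r = h c \<Longrightarrow> r < c"
    and "j \<in> N \<Longrightarrow> \<exists>c\<in>C. h c = Some j"
    and "j \<in> N \<union> P \<Longrightarrow> \<exists>r\<in>R. h r = Some j"
  using assms unfolding colourings_def mem_Collect_eq by simp_all

lemma colourings_empty:
  "colourings {} {} N P Q = (if N = {} \<and> P = {} then {Map.empty} else {})"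
  unfolding colourings_def by auto

lemma colourings_fresh:
  assumes "h \<in> colourings R C N P Q" "x \<notin> R \<union> C"
  shows "h x = None"
  using colouringsD(1)[OF assms(1)] assms(2) by blast

text \<open>
  Removing the largest label \<open>x\<close> updates the state of its block. Columns may go to untouched or
  open blocks; in both cases the block is open afterwards, which allows a single union.
\<close>
lemma colourings_insert_column:
  assumes x: "x \<notin> R \<union> C" "\<And>y. y \<in> R \<union> C \<Longrightarrow> y < x"
  shows "colourings R (insert x C) N P Q =
    (\<Union>j\<in>N \<union> P. (\<lambda>h. h(x \<mapsto> j)) ` colourings R C (N - {j}) (insert j P) Q)"
proof (intro subset_antisym subsetI)
  fix h assume h: "h \<in> colourings R (insert x C) N P Q"
  note D = colouringsD[OF h]
  obtain j where j: "j \<in> N \<union> P" "h x = Some j" using D(2)[of x] by blast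
  define g where "g = h(x := None)"
  have g: "g y = h y" if "y \<in> R \<union> C" for y using that x(1) by (auto simp: g_def)
  have "g \<in> colourings R C (N - {j}) (insert j P) Q"
  proof (rule colouringsI)
    show "dom g \<subseteq> R \<union> C" using D(1) by (auto simp: g_def)
  next
    fix c assume "c \<in> C"
    then show "\<exists>i\<in>(N - {j}) \<union> insert j P. g c = Some i" using D(2)[of c] g[of c] by auto
  next
    fix r i assume "r \<in> R" "g r = Some i"
    then show "i \<in> (N - {j}) \<union> insert j P \<union> Q" using D(3)[of r i] g[of r] by auto
  next
    fix r c assume "r \<in> R" "c \<in> C" "g r = g c"
    then show "r < c" using D(4)[of r c] g[of r] g[of c] by simp
  next
    fix i assume i: "i \<in> N - {j}"
    then obtain c where "c \<in> insert x C" "h c = Some i" using D(5)[of i] by blast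
    moreover from this have "c \<noteq> x" using i j(2) by auto
    ultimately show "\<exists>c\<in>C. g c = Some i" using g by auto
  next
    fix i assume "i \<in> (N - {j}) \<union> insert j P"
    then have "i \<in> N \<union> P" using j(1) by blast
    then show "\<exists>r\<in>R. g r = Some i" using D(6)[of i] g by auto
  qed
  moreover have "h = g(x \<mapsto> j)" using j(2) by (auto simp: fun_eq_iff g_def)
  ultimately show "h \<in> (\<Union>j\<in>N \<union> P. (\<lambda>h. h(x \<mapsto> j)) ` colourings R C (N - {j}) (insert j P) Q)"
    using j(1) by blast
next
  fix h assume "h \<in> (\<Union>j\<in>N \<union> P. (\<lambda>h. h(x \<mapsto> j)) ` colourings R C (N - {j}) (insert j P) Q)"
  then obtain j g where j: "j \<in> N \<union> P" and g: "g \<in> colourings R C (N - {j}) (insert j P) Q"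
    and h: "h = g(x \<mapsto> j)"
    by blast
  note D = colouringsD[OF g]
  have hy: "h y = g y" if "y \<in> R \<union> C" for y using that x(1) by (auto simp: h)
  have hx: "h x = Some j" by (simp add: h)
  show "h \<in> colourings R (insert x C) N P Q"
  proof (rule colouringsI)
    show "dom h \<subseteq> R \<union> insert x C" using D(1) by (auto simp: h)
  next
    fix c assume "c \<in> insert x C"
    then show "\<exists>i\<in>N \<union> P. h c = Some i" using D(2)[of c] hx hy[of c] j by auto
  next
    fix r i assume "r \<in> R" "h r = Some i"
    then show "i \<in> N \<union> P \<union> Q" using D(3)[of r i] hy[of r] j by auto
  next
    fix r c assume "r \<in> R" "c \<in> insert x C" "h r = h c"
    then show "r < c" using D(4)[of r c] hy[of r] hy[of c] x(2)[of r] by auto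
  next
    fix i assume i: "i \<in> N"
    show "\<exists>c\<in>insert x C. h c = Some i"
    proof (cases "i = j")
      case False
      then obtain c where "c \<in> C" "g c = Some i" using D(5)[of i] i by blast
      then show ?thesis using hy[of c] by auto
    qed (use hx in blast)
  next
    fix i assume "i \<in> N \<union> P"
    then obtain r where "r \<in> R" "g r = Some i" using D(6)[of i] by blast
    then show "\<exists>r\<in>R. h r = Some i" using hy[of r] by auto
  qed
qed

text \<open>
  A used row that is the largest label cannot lie in an untouched block: the block would need
  a smaller column, against \<open>r < c\<close>. For the same reason its block gets no further column.
\<close>
lemma colourings_insert_row:
  assumes x: "x \<notin> R \<union> C" "\<And>y. y \<in> R \<union> C \<Longrightarrow> y < x"
    and disj: "N \<inter> P = {}" "N \<inter> Q = {}" "P \<inter> Q = {}"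
  shows "colourings (insert x R) C N P Q = colourings R C N P Q \<union>
    (\<Union>j\<in>P \<union> Q. (\<lambda>h. h(x \<mapsto> j)) ` colourings R C N (P - {j}) (insert j Q))"
    (is "_ = _ \<union> ?U")
proof (intro subset_antisym subsetI)
  fix h assume h: "h \<in> colourings (insert x R) C N P Q"
  note D = colouringsD[OF h]
  show "h \<in> colourings R C N P Q \<union> ?U"
  proof (cases "h x")
    case None
    have "h \<in> colourings R C N P Q"
    proof (rule colouringsI)
      show "dom h \<subseteq> R \<union> C" using D(1) None by auto
    next
      fix j assume "j \<in> N \<union> P"
      then obtain r where "r \<in> insert x R" "h r = Some j" using D(6)[of j] by blast
      then show "\<exists>r\<in>R. h r = Some j" using None by auto
    qed (use D in blast)+
    then show ?thesis by blast
  next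
    case (Some j)
    have free: "h c \<noteq> Some j" if "c \<in> C" for c
    proof
      assume "h c = Some j"
      then have "x < c" using D(4)[of x c] Some that by simp
      moreover have "c < x" using x(2)[of c] that by blast
      ultimately show False by simp
    qed
    have j: "j \<in> P \<union> Q"
    proof -
      have "j \<notin> N" using D(5)[of j] free by blast
      then show ?thesis using D(3)[of x j] Some by blast
    qed
    define g where "g = h(x := None)"
    have g: "g y = h y" if "y \<in> R \<union> C" for y using that x(1) by (auto simp: g_def)
    have "g \<in> colourings R C N (P - {j}) (insert j Q)"
    proof (rule colouringsI)
      show "dom g \<subseteq> R \<union> C" using D(1) by (auto simp: g_def)
    next
      fix c assume c: "c \<in> C"
      then obtain i where i: "i \<in> N \<union> P" "h c = Some i" using D(2)[of c] by blast
      moreover have "i \<noteq> j" using i(2) free[OF c] by blast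
      ultimately show "\<exists>i\<in>N \<union> (P - {j}). g c = Some i" using g[of c] c by auto
    next
      fix r i assume "r \<in> R" "g r = Some i"
      then show "i \<in> N \<union> (P - {j}) \<union> insert j Q" using D(3)[of r i] g[of r] by auto
    next
      fix r c assume "r \<in> R" "c \<in> C" "g r = g c"
      then show "r < c" using D(4)[of r c] g[of r] g[of c] by simp
    next
      fix i assume "i \<in> N"
      then obtain c where "c \<in> C" "h c = Some i" using D(5)[of i] by blast
      then show "\<exists>c\<in>C. g c = Some i" using g[of c] by auto
    next
      fix i assume i: "i \<in> N \<union> (P - {j})"
      then obtain r where "r \<in> insert x R" "h r = Some i" using D(6)[of i] by blast
      moreover have "i \<noteq> j" using i j disj by blast
      ultimately have "r \<in> R" "g r = Some i" using Some g[of r] by auto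
      then show "\<exists>r\<in>R. g r = Some i" by blast
    qed
    moreover have "h = g(x \<mapsto> j)" using Some by (auto simp: fun_eq_iff g_def)
    ultimately show ?thesis using j by blast
  qed
next
  fix h assume "h \<in> colourings R C N P Q \<union> ?U"
  then show "h \<in> colourings (insert x R) C N P Q"
  proof
    assume h: "h \<in> colourings R C N P Q"
    note D = colouringsD[OF h]
    have hx: "h x = None" by (rule colourings_fresh[OF h x(1)])
    show ?thesis
    proof (rule colouringsI)
      fix r j assume "r \<in> insert x R" "h r = Some j"
      then show "j \<in> N \<union> P \<union> Q" using D(3)[of r j] hx by auto
    next
      fix r c assume r: "r \<in> insert x R" "c \<in> C" "h r = h c"
      obtain i where "h c = Some i" using D(2)[of c] r(2) by blast
      then have "r \<in> R" using r hx by auto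
      then show "r < c" using D(4)[of r c] r by blast
    qed (use D in blast)+
  next
    assume "h \<in> ?U"
    then obtain j g where j: "j \<in> P \<union> Q" and g: "g \<in> colourings R C N (P - {j}) (insert j Q)"
      and h: "h = g(x \<mapsto> j)"
      by blast
    note D = colouringsD[OF g]
    have hy: "h y = g y" if "y \<in> R \<union> C" for y using that x(1) by (auto simp: h)
    have hx: "h x = Some j" by (simp add: h)
    show ?thesis
    proof (rule colouringsI)
      show "dom h \<subseteq> insert x R \<union> C" using D(1) by (auto simp: h)
    next
      fix c assume "c \<in> C"
      then show "\<exists>i\<in>N \<union> P. h c = Some i" using D(2)[of c] hy[of c] by auto
    next
      fix r i assume "r \<in> insert x R" "h r = Some i"
      then show "i \<in> N \<union> P \<union> Q" using D(3)[of r i] hx hy[of r] j by auto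
    next
      fix r c assume r: "r \<in> insert x R" "c \<in> C" "h r = h c"
      obtain i where i: "i \<in> N \<union> (P - {j})" "g c = Some i" using D(2)[of c] r(2) by blast
      then have "i \<noteq> j" using j disj by blast
      then have "r \<noteq> x" using r hx hy[of c] i(2) by auto
      then show "r < c" using D(4)[of r c] hy[of r] hy[of c] r by auto
    next
      fix i assume "i \<in> N"
      then obtain c where "c \<in> C" "g c = Some i" using D(5)[of i] by blast
      then show "\<exists>c\<in>C. h c = Some i" using hy[of c] by auto
    next
      fix i assume i: "i \<in> N \<union> P"
      show "\<exists>r\<in>insert x R. h r = Some i"
      proof (cases "i = j")
        case False
        then obtain r where "r \<in> R" "g r = Some i" using D(6)[of i] i by blast
        then show ?thesis using hy[of r] by auto
      qed (use hx in blast)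
    qed
  qed
qed

lemma card_map_update_UN:
  assumes "finite J" "\<And>j. j \<in> J \<Longrightarrow> finite (A j)"
    and "\<And>j h. j \<in> J \<Longrightarrow> h \<in> A j \<Longrightarrow> h x = None"
  shows "finite (\<Union>j\<in>J. (\<lambda>h. h(x \<mapsto> j)) ` A j)"
    and "card (\<Union>j\<in>J. (\<lambda>h. h(x \<mapsto> j)) ` A j) = (\<Sum>j\<in>J. card (A j))"
proof -
  let ?f = "\<lambda>j h. h(x \<mapsto> j)"
  show "finite (\<Union>j\<in>J. ?f j ` A j)" using assms by blast
  have "card (\<Union>j\<in>J. ?f j ` A j) = (\<Sum>j\<in>J. card (?f j ` A j))"
  proof (rule card_UN_disjoint)
    show "\<forall>i\<in>J. \<forall>j\<in>J. i \<noteq> j \<longrightarrow> ?f i ` A i \<inter> ?f j ` A j = {}"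
      by (auto dest: fun_cong[of _ _ x])
  qed (use assms in auto)
  also have "\<dots> = (\<Sum>j\<in>J. card (A j))"
  proof (rule sum.cong)
    fix j assume j: "j \<in> J"
    have "inj_on (?f j) (A j)"
    proof (rule inj_onI)
      fix g h assume gh: "g \<in> A j" "h \<in> A j" "?f j g = ?f j h"
      have "g x = None" "h x = None" using assms(3)[OF j] gh(1,2) by blast+
      then show "g = h" using gh(3) by (metis fun_upd_triv fun_upd_upd)
    qed
    then show "card (?f j ` A j) = card (A j)" by (rule card_image)
  qed simp
  finally show "card (\<Union>j\<in>J. ?f j ` A j) = (\<Sum>j\<in>J. card (A j))" .
qed

text \<open>
  No step lowers the number of blocks \<open>p + q\<close>.
\<close>
lemma sized_completions_eq_0: "m < p + q \<Longrightarrow> sized_completions m w p q = 0"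
proof (induction w arbitrary: p q)
  case (Cons b w)
  then show ?case by (cases b; cases p) simp_all
qed auto

text \<open>
  The factorial counts the ways to assign the numbers in \<open>N\<close> to the blocks that are still to be
  opened, in the order in which they are opened.
\<close>
lemma card_colourings:
  assumes "sorted_wrt (>) xs" "finite N" "finite P" "finite Q"
    and "N \<inter> P = {}" "N \<inter> Q = {}" "P \<inter> Q = {}"
  shows "finite (colourings (R \<inter> set xs) (set xs - R) N P Q) \<and>
    card (colourings (R \<inter> set xs) (set xs - R) N P Q) =
      fact (card N) *
      sized_completions (card N + card P + card Q) (map (\<lambda>x. x \<in> R) xs) (card P) (card Q)"
  using assms
proof (induction xs arbitrary: N P Q)
  case Nil
  then show ?case by (auto simp: colourings_empty)
next
  case (Cons x xs)
  note fin = Cons.prems(2-4) and disj = Cons.prems(5-7)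
  let ?A = "colourings (R \<inter> set xs) (set xs - R)"
  let ?n = "card N" and ?p = "card P" and ?q = "card Q"
  let ?u = "sized_completions (?n + ?p + ?q) (map (\<lambda>x. x \<in> R) xs)"
  have x: "x \<notin> R \<inter> set xs \<union> (set xs - R)" "\<And>y. y \<in> R \<inter> set xs \<union> (set xs - R) \<Longrightarrow> y < x"
    using Cons.prems(1) by auto
  have fresh: "h x = None" if "h \<in> ?A N' P' Q'" for h N' P' Q'
    using colourings_fresh[OF that x(1)] .
  have IH: "finite (?A N' P' Q') \<and> card (?A N' P' Q') = fact (card N') *
      sized_completions (card N' + card P' + card Q') (map (\<lambda>x. x \<in> R) xs) (card P') (card Q')"
    if "finite N'" "finite P'" "finite Q'" "N' \<inter> P' = {}" "N' \<inter> Q' = {}" "P' \<inter> Q' = {}"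
    for N' P' Q'
    using Cons.prems(1) that by (intro Cons.IH) auto
  show ?case
  proof (cases "x \<in> R")
    case False
    let ?B = "\<lambda>j. ?A (N - {j}) (insert j P) Q"
    have N: "card (?B j) = fact (?n - 1) * ?u (Suc ?p) ?q" if "j \<in> N" for j
    proof -
      have j: "j \<notin> P" "j \<notin> Q" "?n > 0" using that disj fin by (auto simp: card_gt_0_iff)
      have "card (?B j) = fact (card (N - {j})) * sized_completions
          (card (N - {j}) + card (insert j P) + ?q) (map (\<lambda>x. x \<in> R) xs) (card (insert j P)) ?q"
        using fin disj j by (intro IH[THEN conjunct2]) auto
      then show ?thesis using fin j that by simp
    qed
    have P: "card (?B j) = fact ?n * ?u ?p ?q" if "j \<in> P" for j
    proof -
      have "N - {j} = N" "insert j P = P" using that disj by auto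
      then show ?thesis using IH[of N P Q] fin disj by simp
    qed
    have B: "finite (?B j)" if "j \<in> N \<union> P" for j
      using that fin disj by (intro IH[THEN conjunct1]) auto
    have sets: "colourings (R \<inter> set (x # xs)) (set (x # xs) - R) N P Q =
        (\<Union>j\<in>N \<union> P. (\<lambda>h. h(x \<mapsto> j)) ` ?B j)"
      using colourings_insert_column[OF x] False by (simp add: insert_Diff_if)
    have "(\<Sum>j\<in>N \<union> P. card (?B j)) = (\<Sum>j\<in>N. card (?B j)) + (\<Sum>j\<in>P. card (?B j))"
      using fin disj by (intro sum.union_disjoint) auto
    also have "\<dots> = ?n * (fact (?n - 1) * ?u (Suc ?p) ?q) + ?p * (fact ?n * ?u ?p ?q)"
      using N P by simp
    (* If N is empty, opening a further block would exceed the number of blocks. *)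
    also have "\<dots> = fact ?n * (?p * ?u ?p ?q + ?u (Suc ?p) ?q)"
      by (cases ?n) (simp_all add: sized_completions_eq_0 algebra_simps)
    finally show ?thesis
      unfolding sets using card_map_update_UN[of "N \<union> P" ?B x] B fresh fin False by simp
  next
    case True
    let ?B = "\<lambda>j. ?A N (P - {j}) (insert j Q)"
    have P: "card (?B j) = fact ?n * ?u (?p - 1) (Suc ?q)" if "j \<in> P" for j
    proof -
      have j: "j \<notin> N" "j \<notin> Q" "?p > 0" using that disj fin by (auto simp: card_gt_0_iff)
      have "card (?B j) = fact ?n * sized_completions
          (?n + card (P - {j}) + card (insert j Q)) (map (\<lambda>x. x \<in> R) xs)
          (card (P - {j})) (card (insert j Q))"
        using fin disj j by (intro IH[THEN conjunct2]) auto
      then show ?thesis using fin j that by simp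
    qed
    have Q: "card (?B j) = fact ?n * ?u ?p ?q" if "j \<in> Q" for j
    proof -
      have "P - {j} = P" "insert j Q = Q" using that disj by auto
      then show ?thesis using IH[of N P Q] fin disj by simp
    qed
    have B: "finite (?B j)" if "j \<in> P \<union> Q" for j
      using that fin disj by (intro IH[THEN conjunct1]) auto
    define U where "U = (\<Union>j\<in>P \<union> Q. (\<lambda>h. h(x \<mapsto> j)) ` ?B j)"
    have sets: "colourings (R \<inter> set (x # xs)) (set (x # xs) - R) N P Q = ?A N P Q \<union> U"
      using colourings_insert_row[OF x disj] True by (simp add: insert_Diff_if U_def)
    have U: "finite U" "card U = (\<Sum>j\<in>P \<union> Q. card (?B j))"
      using card_map_update_UN[of "P \<union> Q" ?B x] B fresh fin
      unfolding U_def by simp_all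
    have A: "finite (?A N P Q)" "card (?A N P Q) = fact ?n * ?u ?p ?q"
      using IH[of N P Q] fin disj by simp_all
    have "?A N P Q \<inter> U = {}"
    proof (rule equals0I)
      fix h assume h: "h \<in> ?A N P Q \<inter> U"
      then have "h x = None" using fresh[of h N P Q] by simp
      then show False using h by (auto simp: U_def)
    qed
    then have "card (?A N P Q \<union> U) = card (?A N P Q) + card U"
      using A(1) U(1) by (intro card_Un_disjoint)
    also have "card U = (\<Sum>j\<in>P. card (?B j)) + (\<Sum>j\<in>Q. card (?B j))"
      unfolding U(2) using fin disj by (intro sum.union_disjoint) auto
    also have "\<dots> = ?p * (fact ?n * ?u (?p - 1) (Suc ?q)) + ?q * (fact ?n * ?u ?p ?q)"
      using P Q by simp
    finally have "card (?A N P Q \<union> U) =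
        fact ?n * (Suc ?q * ?u ?p ?q + ?p * ?u (?p - 1) (Suc ?q))"
      unfolding A(2) by (simp add: algebra_simps)
    then show ?thesis
      unfolding sets using A(1) U(1) True by simp
  qed
qed

section \<open>Callan sequences as colourings\<close>

definition colour_classes ::
    "nat set \<Rightarrow> nat set \<Rightarrow> nat \<Rightarrow> (nat \<rightharpoonup> nat) \<Rightarrow> (nat set \<times> nat set) list" where
  "colour_classes R C m h =
     map (\<lambda>j. ({r \<in> R. h r = Some j}, {c \<in> C. h c = Some j})) [0..<m]"

text \<open>
  A reading of the definition by positions, in which the comparison of \<open>Max\<close> and \<open>Min\<close> becomes
  a comparison of elements.
\<close>
lemma callan_sequence_iff:
  assumes "finite (row_labels lam)" "finite (col_labels lam)"
  shows "callan_sequence lam S \<longleftrightarrow>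
    (\<forall>i<length S. fst (S ! i) \<noteq> {} \<and> fst (S ! i) \<subseteq> row_labels lam \<and>
       snd (S ! i) \<noteq> {} \<and> snd (S ! i) \<subseteq> col_labels lam \<and>
       (\<forall>r\<in>fst (S ! i). \<forall>c\<in>snd (S ! i). r < c)) \<and>
    (\<forall>i<length S. \<forall>j<length S. i \<noteq> j \<longrightarrow>
       fst (S ! i) \<inter> fst (S ! j) = {} \<and> snd (S ! i) \<inter> snd (S ! j) = {})"
proof -
  have max: "Max A < Min B \<longleftrightarrow> (\<forall>r\<in>A. \<forall>c\<in>B. r < c)"
    if "A \<noteq> {}" "B \<noteq> {}" "A \<subseteq> row_labels lam" "B \<subseteq> col_labels lam" for A B
  proof -
    have "finite A" "finite B" using that(3,4) assms by (auto intro: finite_subset)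
    then show ?thesis using that(1,2) by (auto simp: Max_less_iff Min_gr_iff)
  qed
  have pair: "A \<noteq> {} \<and> A \<subseteq> row_labels lam \<and> B \<noteq> {} \<and> B \<subseteq> col_labels lam \<and> Max A < Min B \<longleftrightarrow>
      A \<noteq> {} \<and> A \<subseteq> row_labels lam \<and> B \<noteq> {} \<and> B \<subseteq> col_labels lam \<and> (\<forall>r\<in>A. \<forall>c\<in>B. r < c)" for A B
    using max[of A B] by argo
  have "(\<forall>(A, B) \<in> set S. A \<noteq> {} \<and> A \<subseteq> row_labels lam \<and>
      B \<noteq> {} \<and> B \<subseteq> col_labels lam \<and> Max A < Min B) \<longleftrightarrow>
    (\<forall>(A, B) \<in> set S. A \<noteq> {} \<and> A \<subseteq> row_labels lam \<and>
      B \<noteq> {} \<and> B \<subseteq> col_labels lam \<and> (\<forall>r\<in>A. \<forall>c\<in>B. r < c))"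
    unfolding pair by (rule refl)
  also have "\<dots> \<longleftrightarrow> (\<forall>i<length S. fst (S ! i) \<noteq> {} \<and> fst (S ! i) \<subseteq> row_labels lam \<and>
       snd (S ! i) \<noteq> {} \<and> snd (S ! i) \<subseteq> col_labels lam \<and>
       (\<forall>r\<in>fst (S ! i). \<forall>c\<in>snd (S ! i). r < c))"
    unfolding all_set_conv_all_nth case_prod_beta by (rule refl)
  finally have blocks: "(\<forall>(A, B) \<in> set S. A \<noteq> {} \<and> A \<subseteq> row_labels lam \<and>
      B \<noteq> {} \<and> B \<subseteq> col_labels lam \<and> Max A < Min B) \<longleftrightarrow>
    (\<forall>i<length S. fst (S ! i) \<noteq> {} \<and> fst (S ! i) \<subseteq> row_labels lam \<and>
       snd (S ! i) \<noteq> {} \<and> snd (S ! i) \<subseteq> col_labels lam \<and>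
       (\<forall>r\<in>fst (S ! i). \<forall>c\<in>snd (S ! i). r < c))" .
  have "disjoint_family_on (\<lambda>i. fst (S ! i)) {..<length S} \<and>
      disjoint_family_on (\<lambda>i. snd (S ! i)) {..<length S} \<longleftrightarrow>
    (\<forall>i<length S. \<forall>j<length S. i \<noteq> j \<longrightarrow>
       fst (S ! i) \<inter> fst (S ! j) = {} \<and> snd (S ! i) \<inter> snd (S ! j) = {})"
    unfolding disjoint_family_on_def Ball_def lessThan_iff by blast
  with blocks show ?thesis unfolding callan_sequence_def by (simp only:)
qed

lemma complete_callan_sequences_iff:
  assumes "finite (row_labels lam)" "finite (col_labels lam)"
  shows "S \<in> complete_callan_sequences lam \<longleftrightarrow>
    (\<forall>i<length S. fst (S ! i) \<noteq> {} \<and> fst (S ! i) \<subseteq> row_labels lam \<and>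
       snd (S ! i) \<noteq> {} \<and> snd (S ! i) \<subseteq> col_labels lam \<and>
       (\<forall>r\<in>fst (S ! i). \<forall>c\<in>snd (S ! i). r < c)) \<and>
    (\<forall>i<length S. \<forall>j<length S. i \<noteq> j \<longrightarrow>
       fst (S ! i) \<inter> fst (S ! j) = {} \<and> snd (S ! i) \<inter> snd (S ! j) = {}) \<and>
    (\<forall>c\<in>col_labels lam. \<exists>i<length S. c \<in> snd (S ! i))"
    (is "_ \<longleftrightarrow> ?blocks \<and> ?disj \<and> ?cover")
proof -
  have union: "(\<Union>(A, B) \<in> set S. B) = (\<Union>i<length S. snd (S ! i))"
    by (auto simp: set_conv_nth case_prod_beta)
  have "(\<Union>i<length S. snd (S ! i)) = col_labels lam \<longleftrightarrow> ?cover" if ?blocks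
    using that by blast
  then have "(?blocks \<and> ?disj) \<and> (\<Union>i<length S. snd (S ! i)) = col_labels lam \<longleftrightarrow>
      ?blocks \<and> ?disj \<and> ?cover"
    by (simp only: conj_assoc cong: conj_cong)
  then show ?thesis
    unfolding complete_callan_sequences_def mem_Collect_eq union callan_sequence_iff[OF assms] .
qed

lemma bij_betw_colour_classes:
  fixes lam m
  defines "R \<equiv> row_labels lam" and "C \<equiv> col_labels lam"
  assumes fin: "finite R" "finite C" and disj: "R \<inter> C = {}"
  shows "bij_betw (colour_classes R C m) (colourings R C {..<m} {} {})
           {S \<in> complete_callan_sequences lam. length S = m}"
proof (rule bij_betwI')
  note complete = complete_callan_sequences_iff[OF fin[unfolded R_def C_def], folded R_def C_def]
  have len: "length (colour_classes R C m h) = m" for h by (simp add: colour_classes_def)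
  have nth: "fst (colour_classes R C m h ! j) = {r \<in> R. h r = Some j}"
    "snd (colour_classes R C m h ! j) = {c \<in> C. h c = Some j}" if "j < m" for h j
    using that by (simp_all add: colour_classes_def)
  {
    fix h h'
    assume h: "h \<in> colourings R C {..<m} {} {}" and h': "h' \<in> colourings R C {..<m} {} {}"
    show "colour_classes R C m h = colour_classes R C m h' \<longleftrightarrow> h = h'"
    proof
      assume eq: "colour_classes R C m h = colour_classes R C m h'"
      have same: "h x = Some j \<longleftrightarrow> h' x = Some j" if "x \<in> R \<union> C" "j < m" for x j
        using nth[OF that(2), of h] nth[OF that(2), of h'] that(1) unfolding eq by blast
      have range: "j < m" if "k \<in> colourings R C {..<m} {} {}" "x \<in> R \<union> C" "k x = Some j" for k x j
        using colouringsD(2,3)[OF that(1), of x] that(2,3) by auto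
      have "h x = h' x" for x
      proof (cases "x \<in> R \<union> C")
        case True
        have "h x = Some j \<longleftrightarrow> h' x = Some j" for j
          using same[OF True, of j] range[OF h True, of j] range[OF h' True, of j] by blast
        then show ?thesis by (metis option.exhaust)
      next
        case False
        then show ?thesis using colourings_fresh[OF h False] colourings_fresh[OF h' False] by simp
      qed
      then show "h = h'" by (rule ext)
    qed simp
  next
    fix h
    assume h: "h \<in> colourings R C {..<m} {} {}"
    note D = colouringsD[OF h]
    let ?S = "colour_classes R C m h"
    have "?S \<in> complete_callan_sequences lam"
      unfolding complete len
    proof (intro conjI allI impI ballI)
      fix i assume i: "i < m"
      show "fst (?S ! i) \<noteq> {}" using D(6)[of i] i by (auto simp: nth[OF i])
      show "snd (?S ! i) \<noteq> {}" using D(5)[of i] i by (auto simp: nth[OF i])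
      show "fst (?S ! i) \<subseteq> R" "snd (?S ! i) \<subseteq> C" by (auto simp: nth[OF i])
      fix r c assume "r \<in> fst (?S ! i)" "c \<in> snd (?S ! i)"
      then show "r < c" using D(4)[of r c] by (simp add: nth[OF i])
    next
      fix i j assume "i < m" "j < m" "i \<noteq> j"
      then show "fst (?S ! i) \<inter> fst (?S ! j) = {}" "snd (?S ! i) \<inter> snd (?S ! j) = {}"
        by (auto simp: nth)
    next
      fix c assume "c \<in> C"
      then show "\<exists>i<m. c \<in> snd (?S ! i)" using D(2)[of c] nth(2) by auto
    qed
    then show "?S \<in> {S \<in> complete_callan_sequences lam. length S = m}" by (simp add: len)
  next
    fix S
    assume S: "S \<in> {S \<in> complete_callan_sequences lam. length S = m}"
    then have m: "length S = m" and "S \<in> complete_callan_sequences lam" by simp_all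
    note conds = this(2)[unfolded complete m]
    have blocks: "fst (S ! i) \<noteq> {}" "fst (S ! i) \<subseteq> R" "snd (S ! i) \<noteq> {}"
        "snd (S ! i) \<subseteq> C" "\<forall>r\<in>fst (S ! i). \<forall>c\<in>snd (S ! i). r < c" if "i < m" for i
      using conds[THEN conjunct1] that by simp_all
    have separate: "fst (S ! i) \<inter> fst (S ! j) = {} \<and> snd (S ! i) \<inter> snd (S ! j) = {}"
        if "i < m" "j < m" "i \<noteq> j" for i j
      using conds[THEN conjunct2, THEN conjunct1] that by blast
    have cover: "\<exists>i<m. c \<in> snd (S ! i)" if "c \<in> C" for c
      using conds[THEN conjunct2, THEN conjunct2] that by blast
    let ?in = "\<lambda>x i. i < m \<and> x \<in> fst (S ! i) \<union> snd (S ! i)"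
    define h where "h x = (if \<exists>i. ?in x i then Some (SOME i. ?in x i) else None)" for x
    have unique: "i = j" if i: "?in x i" and j: "?in x j" for x i j
    proof (rule ccontr)
      assume "i \<noteq> j"
      with i j have "fst (S ! i) \<inter> fst (S ! j) = {}" "snd (S ! i) \<inter> snd (S ! j) = {}"
        using separate by blast+
      moreover have "fst (S ! i) \<inter> snd (S ! j) = {}" "snd (S ! i) \<inter> fst (S ! j) = {}"
        using blocks(2,4)[of i] blocks(2,4)[of j] i j disj by blast+
      ultimately show False using i j by blast
    qed
    have h: "h x = Some i \<longleftrightarrow> ?in x i" for x i
    proof (cases "\<exists>i. ?in x i")
      case True
      define k where "k = (SOME i. ?in x i)"
      have k: "?in x k" unfolding k_def using True by (rule someI_ex)
      have "h x = Some k" unfolding h_def k_def by (rule if_P[OF True])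
      moreover have "k = i \<longleftrightarrow> ?in x i" using k unique[of k x i] by blast
      ultimately show ?thesis by (simp only: option.inject)
    next
      case False
      then have "h x = None" unfolding h_def by (rule if_not_P)
      then show ?thesis using False by simp
    qed
    have rows: "h r = Some i \<longleftrightarrow> i < m \<and> r \<in> fst (S ! i)" if "r \<in> R" for r i
      using blocks(4)[of i] disj that unfolding h by blast
    have columns: "h c = Some i \<longleftrightarrow> i < m \<and> c \<in> snd (S ! i)" if "c \<in> C" for c i
      using blocks(2)[of i] disj that unfolding h by blast
    have "h \<in> colourings R C {..<m} {} {}"
    proof (rule colouringsI)
      show "dom h \<subseteq> R \<union> C"
      proof
        fix x assume "x \<in> dom h"
        then obtain i where "h x = Some i" by blast
        then have "?in x i" by (simp only: h)
        then show "x \<in> R \<union> C" using blocks(2,4)[of i] by blast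
      qed
    next
      fix c assume "c \<in> C"
      then show "\<exists>j\<in>{..<m} \<union> {}. h c = Some j" using cover[of c] columns[of c] by auto
    next
      fix r j assume "r \<in> R" "h r = Some j"
      then show "j \<in> {..<m} \<union> {} \<union> {}" using h by simp
    next
      fix r c assume rc: "r \<in> R" "c \<in> C" "h r = h c"
      obtain i where "i < m" "c \<in> snd (S ! i)" using cover[OF rc(2)] by blast
      moreover from this have "r \<in> fst (S ! i)"
        using rc rows[OF rc(1), of i] columns[OF rc(2), of i] by simp
      ultimately show "r < c" using blocks(5)[of i] by blast
    next
      fix j assume "j \<in> {..<m}"
      then have j: "j < m" by simp
      then obtain c where "c \<in> snd (S ! j)" using blocks(3)[OF j] by blast
      then show "\<exists>c\<in>C. h c = Some j" using blocks(4)[OF j] columns[of c j] j by blast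
    next
      fix j assume "j \<in> {..<m} \<union> {}"
      then have j: "j < m" by simp
      then obtain r where "r \<in> fst (S ! j)" using blocks(1)[OF j] by blast
      then show "\<exists>r\<in>R. h r = Some j" using blocks(2)[OF j] rows[of r j] j by blast
    qed
    moreover have "S = colour_classes R C m h"
    proof (rule nth_equalityI)
      fix i assume "i < length S"
      then have i: "i < m" by (simp add: m)
      have "fst (S ! i) = {r \<in> R. h r = Some i}" using rows blocks(2)[OF i] i by blast
      moreover have "snd (S ! i) = {c \<in> C. h c = Some i}" using columns blocks(4)[OF i] i by blast
      ultimately show "S ! i = colour_classes R C m h ! i" by (simp add: prod_eq_iff nth[OF i])
    qed (simp add: m len)
    ultimately show "\<exists>h\<in>colourings R C {..<m} {} {}. S = colour_classes R C m h" by blast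
  }
qed

text \<open>
  This bounds the range of the sum over the number of blocks.
\<close>
lemma length_complete_callan_sequence:
  assumes "finite (row_labels lam)" "finite (col_labels lam)" "S \<in> complete_callan_sequences lam"
  shows "length S \<le> card (col_labels lam)"
proof -
  note S = assms(3)[unfolded complete_callan_sequences_iff[OF assms(1,2)]]
  define f where "f i = (SOME c. c \<in> snd (S ! i))" for i
  have block: "snd (S ! i) \<noteq> {}" "snd (S ! i) \<subseteq> col_labels lam" if "i < length S" for i
    using S[THEN conjunct1] that by simp_all
  have f: "f i \<in> snd (S ! i)" if "i < length S" for i
    unfolding f_def using block(1)[OF that] by (rule some_in_eq[THEN iffD2])
  have "inj_on f {..<length S}"
  proof (rule inj_onI)
    fix i j assume ij: "i \<in> {..<length S}" "j \<in> {..<length S}" "f i = f j"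
    then have "snd (S ! i) \<inter> snd (S ! j) \<noteq> {}" using f[of i] f[of j] by auto
    then show "i = j" using S[THEN conjunct2, THEN conjunct1] ij(1,2) by auto
  qed
  moreover have "f ` {..<length S} \<subseteq> col_labels lam" using f block(2) by blast
  ultimately have "card {..<length S} \<le> card (col_labels lam)"
    using assms(2) by (rule card_inj_on_le)
  then show ?thesis by simp
qed

text \<open>
  In a Callan sequence of length \<open>m\<close> the positions serve as block numbers, and before any label
  is read all of them are untouched.
\<close>
theorem card_complete_callan_sequences:
  assumes xs: "sorted_wrt (>) xs" and R: "row_labels lam = R \<inter> set xs"
    and C: "col_labels lam = set xs - R"
  shows "finite (complete_callan_sequences lam) \<and>
    card (complete_callan_sequences lam) = completions (map (\<lambda>x. x \<in> R) xs) 0 0"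
proof -
  have fin: "finite (row_labels lam)" "finite (col_labels lam)" using R C by simp_all
  let ?w = "map (\<lambda>x. x \<in> R) xs"
  let ?T = "\<lambda>m. {S \<in> complete_callan_sequences lam. length S = m}"
  have "row_labels lam \<inter> col_labels lam = {}" using R C by blast
  from bij_betw_colour_classes[OF fin this]
  have bij: "bij_betw (colour_classes (row_labels lam) (col_labels lam) m)
      (colourings (R \<inter> set xs) (set xs - R) {..<m} {} {}) (?T m)" for m
    unfolding R C .
  have T: "finite (?T m)" "card (?T m) = fact m * sized_completions m ?w 0 0" for m
    using card_colourings[OF xs, of "{..<m}" "{}" "{}" R] bij_betw_finite[OF bij[of m]]
      bij_betw_same_card[OF bij[of m]] by simp_all
  have "card (col_labels lam) \<le> length xs"
    unfolding C using card_mono[of "set xs" "set xs - R"] card_length[of xs] by simp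
  then have "length S \<le> length xs" if "S \<in> complete_callan_sequences lam" for S
    using length_complete_callan_sequence[OF fin that] by simp
  then have union: "complete_callan_sequences lam = (\<Union>m\<le>length xs. ?T m)" by auto
  have "card (\<Union>m\<le>length xs. ?T m) = (\<Sum>m\<le>length xs. card (?T m))"
    using T(1) by (intro card_UN_disjoint) auto
  also have "\<dots> = completions ?w 0 0"
    using completions_eq_sum_sized[of 0 0 ?w "length xs"] T(2) by simp
  finally have card: "card (\<Union>m\<le>length xs. ?T m) = completions ?w 0 0" .
  have "finite (\<Union>m\<le>length xs. ?T m)" using T(1) by blast
  with card show ?thesis unfolding union[symmetric] by blast
qed

section \<open>Row and column labels\<close>

context
  fixes lam :: "nat list"
  assumes partition: "is_partition lam"
begin

lemma part_antimono:
  assumes "1 \<le> i" "i \<le> i'" "i' \<le> length lam"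
  shows "lam ! (i' - 1) \<le> lam ! (i - 1)"
proof (cases "i = i'")
  case False
  then have "i - 1 < i' - 1" "i' - 1 < length lam" using assms by auto
  then show ?thesis
    using partition by (simp add: is_partition_def sorted_wrt_iff_nth_less)
qed simp

lemma part_le_first_part:
  assumes "1 \<le> i" "i \<le> length lam"
  shows "lam ! (i - 1) \<le> first_part lam"
proof -
  have "lam ! (i - 1) \<le> lam ! 0" using part_antimono[of 1 i] assms by simp
  also have "lam ! 0 = first_part lam" using assms by (cases lam) (auto simp: first_part_def)
  finally show ?thesis .
qed

text \<open>
  The rows that meet a given column form an initial segment, because the parts decrease.
\<close>
lemma col_height_iff:
  assumes i: "1 \<le> i" "i \<le> length lam" and j: "1 \<le> j" "j \<le> first_part lam"
  shows "i \<le> col_height lam j \<longleftrightarrow> first_part lam + 1 - j \<le> lam ! (i - 1)"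
proof -
  let ?k = "first_part lam + 1 - j"
  define H where "H = {i. (i, ?k) \<in> ferrers lam}"
  have mem: "x \<in> H \<longleftrightarrow> 1 \<le> x \<and> x \<le> length lam \<and> ?k \<le> lam ! (x - 1)" for x
    using j by (auto simp: H_def ferrers_def)
  have card: "col_height lam j = card H" by (simp add: col_height_def H_def)
  have "H \<subseteq> {1..length lam}" using mem by auto
  then have fin: "finite H" by (rule finite_subset) simp
  show ?thesis
  proof
    assume k: "?k \<le> lam ! (i - 1)"
    have "{1..i} \<subseteq> H"
    proof
      fix x assume "x \<in> {1..i}"
      then show "x \<in> H" using part_antimono[of x i] k i unfolding mem by auto
    qed
    from card_mono[OF fin this] show "i \<le> col_height lam j" by (simp add: card)
  next
    assume le: "i \<le> col_height lam j"
    show "?k \<le> lam ! (i - 1)"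
    proof (rule ccontr)
      assume k: "\<not> ?k \<le> lam ! (i - 1)"
      have "H \<subseteq> {1..<i}"
      proof
        fix x assume x: "x \<in> H"
        have "\<not> i \<le> x" using part_antimono[of i x] x k i unfolding mem by auto
        then show "x \<in> {1..<i}" using x unfolding mem by simp
      qed
      from card_mono[OF _ this] have "card H \<le> i - 1" by simp
      then show False using le i by (simp add: card)
    qed
  qed
qed

lemma col_height_le: "col_height lam j \<le> length lam"
proof -
  have "{i. (i, first_part lam + 1 - j) \<in> ferrers lam} \<subseteq> {1..length lam}"
    by (auto simp: ferrers_def)
  from card_mono[OF _ this] show ?thesis by (simp add: col_height_def)
qed

lemma inj_on_row_label: "inj_on (row_label lam) {1..length lam}"
proof (rule strict_mono_on_imp_inj_on, rule strict_mono_onI)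
  fix i i' assume "i \<in> {1..length lam}" "i' \<in> {1..length lam}" "i < i'"
  then show "row_label lam i < row_label lam i'"
    using part_antimono[of i i'] part_le_first_part[of i] by (simp add: row_label_def)
qed

lemma inj_on_col_label: "inj_on (col_label lam) {1..first_part lam}"
proof (rule strict_mono_on_imp_inj_on, rule strict_mono_onI)
  fix j j' assume j: "j \<in> {1..first_part lam}" "j' \<in> {1..first_part lam}" "j < j'"
  have "col_height lam j \<le> col_height lam j'"
  proof (cases "col_height lam j = 0")
    case False
    let ?i = "col_height lam j"
    have i: "1 \<le> ?i" "?i \<le> length lam" using False col_height_le by auto
    then have "first_part lam + 1 - j \<le> lam ! (?i - 1)" using col_height_iff[of ?i j] j by simp
    then show ?thesis using col_height_iff[of ?i j'] i j by simp
  qed simp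
  then show "col_label lam j < col_label lam j'" using j by (simp add: col_label_def)
qed

text \<open>
  Let \<open>h\<close> be the height of column \<open>j\<close>. A row \<open>i \<le> h\<close> reaches the column, so its label is
  at most \<open>i + j - 1 < j + h\<close>; a row \<open>i > h\<close> ends before it, so its label is at least
  \<open>i + j > j + h\<close>.
\<close>
lemma row_label_neq_col_label:
  assumes i: "1 \<le> i" "i \<le> length lam" and j: "1 \<le> j" "j \<le> first_part lam"
  shows "row_label lam i \<noteq> col_label lam j"
  using col_height_iff[OF i j] part_le_first_part[OF i] j
  unfolding row_label_def col_label_def by linarith

lemma labels_disjoint: "row_labels lam \<inter> col_labels lam = {}"
  using row_label_neq_col_label by (auto simp: row_labels_def col_labels_def)

text \<open>
  The labels lie in the interval and are as many as its elements.
\<close>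
lemma labels_union: "row_labels lam \<union> col_labels lam = {1..semiperimeter lam}"
proof (rule card_subset_eq)
  show "row_labels lam \<union> col_labels lam \<subseteq> {1..semiperimeter lam}"
  proof
    fix x assume "x \<in> row_labels lam \<union> col_labels lam"
    then consider i where "1 \<le> i" "i \<le> length lam" "x = row_label lam i"
      | j where "1 \<le> j" "j \<le> first_part lam" "x = col_label lam j"
      by (auto simp: row_labels_def col_labels_def)
    then show "x \<in> {1..semiperimeter lam}"
    proof cases
      case 1
      then show ?thesis
        using part_le_first_part[of i] by (auto simp: row_label_def semiperimeter_def)
    next
      case 2
      then show ?thesis
        using col_height_le[of j] by (simp add: col_label_def semiperimeter_def)
    qed
  qed
  have "card (row_labels lam) = length lam" "card (col_labels lam) = first_part lam"
    unfolding row_labels_def col_labels_def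
    using card_image[OF inj_on_row_label] card_image[OF inj_on_col_label] by simp_all
  moreover have "finite (row_labels lam)" "finite (col_labels lam)"
    by (simp_all add: row_labels_def col_labels_def)
  ultimately show "card (row_labels lam \<union> col_labels lam) = card {1..semiperimeter lam}"
    using labels_disjoint by (simp add: card_Un_disjoint semiperimeter_def)
qed simp

end

section \<open>The bijection\<close>

theorem lemma16:
  fixes lam :: "nat list"
  assumes "is_partition lam"
  shows "\<exists>f. bij_betw f (dumont_permutations lam) (complete_callan_sequences lam)"
proof -
  let ?s = "semiperimeter lam" and ?R = "row_labels lam"
  define xs where "xs = rev [1..<Suc ?s]"
  have set_xs: "set xs = {1..?s}" by (auto simp: xs_def)
  have sorted: "sorted_wrt (>) xs" 
    unfolding xs_def sorted_wrt_rev by (simp add: sorted_wrt_upt del: upt_Suc)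
  have rows: "?R = ?R \<inter> set xs" and columns: "col_labels lam = set xs - ?R"
    using labels_disjoint[OF assms] labels_union[OF assms] unfolding set_xs by blast+
  have "{1..?s + 1} = insert (?s + 1) (set xs)" by (auto simp: set_xs)
  then have dumont: "dumont_permutations lam = dumont_words (set xs) (?R \<inter> set xs) (?s + 1)"
    unfolding dumont_permutations_def dumont_words_def permutations_of_set_def rows[symmetric]
    by auto
  have "card (dumont_permutations lam) = completions (map (\<lambda>x. x \<in> ?R) xs) 0 0"
    unfolding dumont by (rule card_dumont_words[OF sorted]) (simp add: set_xs)
  moreover have "finite (dumont_permutations lam)"
    unfolding dumont by (rule finite_dumont_words) simp
  moreover note card_complete_callan_sequences[OF sorted rows columns]
  ultimately show ?thesis by (intro finite_same_card_bij) simp_all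
qed

end
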